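(* Let $r\in(0,1]$ and suppose $\Omega\subset\mathbb{C}^d$ is a $\mathbb{C}$-properly convex domain. If $1\le m\le d$ and $$\Omega\cap\mathrm{Span}_{\mathbb{C}}\{e_1,\dots,e_m\}\in\mathbb{K}_m(r)$$ (identifying $\mathrm{Span}_{\mathbb{C}}\{e_1,\dots,e_m\}$ with $\mathbb{C}^m$), then there exists $A\in\mathrm{GL}_d(\mathbb{C})$ such that $A\Omega\in\mathbb{K}_d(r)$ and $A$ restricted to $\mathrm{Span}_{\mathbb{C}}\{e_1,\dots,e_m\}$ is the identity.
   Context: A convex domain in $\mathbb{C}^k$ is $\mathbb{C}$-properly convex if it contains no entire complex affine line. With $e_1,e_2,\dots$ the standard basis vectors and $\mathbb{D}\subset\mathbb{C}$ the open unit disk, for $k\ge1$ and $r\in(0,1]$ the set $\mathbb{K}_k(r)$ consists of the $\mathbb{C}$-properly convex domains $\Omega\subset\mathbb{C}^k$ such that (i) $r\mathbb{D}\cdot e_1\subset\Omega$ and $\mathbb{D}\cdot e_j\subset\Omega$ for $j=2,\dots,k$; and (ii) for every $j=1,\dots,k$, $e_j\in\partial\Omega$ and $(e_j+\mathrm{Span}_{\mathbb{C}}\{e_{j+1},\dots,e_k\})\cap\Omega=\emptyset$. *)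

theory Defs
  imports "HOL-Analysis.Analysis"
begin

text \<open>
  \<open>\<complex>\<^sup>k\<close> is \<^typ>\<open>complex^'k\<close> with \<open>k = CARD('k)\<close>. The index type is linearly ordered, which numbers
  the coordinates: \<open>coord_index j\<close> is its \<open>j\<close>-th smallest element, for \<open>1 \<le> j \<le> CARD('k)\<close>
  (for other \<open>j\<close> the value is irrelevant).
\<close>

definition coord_index :: "nat \<Rightarrow> 'k::{finite,linorder}" where
  "coord_index j = sorted_list_of_set UNIV ! (j - 1)"

definition std_basis :: "nat \<Rightarrow> complex ^ 'k::{finite,linorder}" where
  "std_basis j = axis (coord_index j) 1"

text \<open>Connectedness of a domain is implied by convexity.\<close>

definition convex_domain :: "(complex ^ 'k) set \<Rightarrow> bool" where
  "convex_domain \<Omega> \<longleftrightarrow> open \<Omega> \<and> \<Omega> \<noteq> {} \<and> convex \<Omega>"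

definition C_properly_convex_domain :: "(complex ^ 'k) set \<Rightarrow> bool" where
  "C_properly_convex_domain \<Omega> \<longleftrightarrow>
     convex_domain \<Omega> \<and> \<not> (\<exists>p v. v \<noteq> 0 \<and> range (\<lambda>z::complex. p + z *s v) \<subseteq> \<Omega>)"

text \<open>The dimension \<open>k = CARD('k)\<close> is carried by the type; \<^const>\<open>vec.span\<close> is the complex span.\<close>

definition KK :: "real \<Rightarrow> (complex ^ 'k::{finite,linorder}) set set" where
  "KK r = {\<Omega>. C_properly_convex_domain \<Omega> \<and>
     (\<lambda>z. z *s std_basis 1) ` ball 0 r \<subseteq> \<Omega> \<and>
     (\<forall>j\<in>{2..CARD('k)}. (\<lambda>z. z *s std_basis j) ` ball 0 1 \<subseteq> \<Omega>) \<and>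
     (\<forall>j\<in>{1..CARD('k)}. std_basis j \<in> frontier \<Omega> \<and>
        (\<lambda>v. std_basis j + v) ` vec.span (std_basis ` {j+1..CARD('k)}) \<inter> \<Omega> = {})}"

text \<open>
  For \<open>CARD('m) \<le> CARD('d)\<close>, the linear map \<open>e\<^sub>j \<mapsto> e\<^sub>j\<close> identifying \<open>\<complex>\<^sup>m\<close> with the span of
  \<open>e\<^sub>1, \<dots>, e\<^sub>m\<close> in \<open>\<complex>\<^sup>d\<close>.
\<close>

definition coord_embed ::
  "complex ^ 'm::{finite,linorder} \<Rightarrow> complex ^ 'd::{finite,linorder}" where
  "coord_embed z = (\<Sum>j = 1..CARD('m). (z $ coord_index j) *s std_basis j)"

end

theory Submission
  imports Defs
begin

text \<open>
  By complex Hahn--Banach, each \<open>e\<^sub>j + span {e\<^sub>j\<^sub>+\<^sub>1, \<dots>, e\<^sub>m}\<close> lies in a complex hyperplane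
  \<open>{f\<^sub>j = 1}\<close> missing \<open>\<Omega>\<close>. Having vectors \<open>v\<^sub>1, \<dots>, v\<^sub>k\<close> (initially \<open>e\<^sub>1, \<dots>, e\<^sub>m\<close>) and functionals
  \<open>f\<^sub>1, \<dots>, f\<^sub>k\<close>, let \<open>v\<^sub>k\<^sub>+\<^sub>1\<close> be a point of \<open>V - \<Omega>\<close> nearest to the origin, where \<open>V\<close> is the common
  kernel of the \<open>f\<^sub>j\<close>; it exists because \<open>\<Omega>\<close> contains no complex line, and minimality puts its
  open unit disc into \<open>\<Omega>\<close>. Hahn--Banach at \<open>v\<^sub>k\<^sub>+\<^sub>1\<close> gives \<open>f\<^sub>k\<^sub>+\<^sub>1\<close>. Once \<open>k = d\<close>, the matrix
  \<open>(f\<^sub>j v\<^sub>i)\<close> is unitriangular, so the \<open>v\<^sub>j\<close> form a basis, and \<open>A\<close> is the linear map with \<open>A v\<^sub>j = e\<^sub>j\<close>.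
\<close>

section \<open>Numbered coordinates and linear maps on complex vectors\<close>

lemma bij_betw_coord_index:
  "bij_betw (coord_index :: nat \<Rightarrow> 'k::{finite,linorder}) {1..CARD('k)} UNIV"
proof -
  let ?xs = "sorted_list_of_set (UNIV :: 'k set)"
  have "bij_betw ((!) ?xs) {..<CARD('k)} UNIV"
    by (rule bij_betw_nth) auto
  moreover have "bij_betw (\<lambda>j. j - 1) {1..CARD('k)} {..<CARD('k)}"
    by (rule bij_betw_byWitness[where f' = Suc]) auto
  ultimately have "bij_betw ((!) ?xs \<circ> (\<lambda>j. j - 1)) {1..CARD('k)} UNIV"
    using bij_betw_trans by blast
  then show ?thesis
    by (simp add: coord_index_def[abs_def] comp_def)
qed

lemma coord_index_eq_iff:
  assumes "i \<in> {1..CARD('k)}" "j \<in> {1..CARD('k)}"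
  shows "(coord_index i :: 'k::{finite,linorder}) = coord_index j \<longleftrightarrow> i = j"
  using bij_betw_coord_index[where 'k = 'k] assms
  by (meson bij_betw_def inj_on_eq_iff)

lemma coord_index_cases:
  obtains j where "j \<in> {1..CARD('k)}" "(i :: 'k::{finite,linorder}) = coord_index j"
  using bij_betw_coord_index[where 'k = 'k] by (metis UNIV_I bij_betw_def imageE)

lemma std_basis_nth_coord_index:
  assumes "i \<in> {1..CARD('k)}" "j \<in> {1..CARD('k)}"
  shows "(std_basis j :: complex ^ 'k::{finite,linorder}) $ coord_index i = (if i = j then 1 else 0)"
  using coord_index_eq_iff[OF assms] by (auto simp: std_basis_def axis_def)

text \<open>Leaving \<open>v\<close> and \<open>n\<close> free serves two purposes:
  \<open>coord_embed\<close> is the case \<open>v = std_basis\<close>, and the change of basis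
  \<open>B\<close> in \<open>adapted_flag_imp_KK\<close> is the case of the flag vectors.\<close>

lemma linear_coord_combination:
  "Vector_Spaces.linear (*s) (*s)
     (\<lambda>x :: complex ^ 'k::{finite,linorder}. \<Sum>j = 1..n. (x $ coord_index j) *s (v j :: complex ^ 'd))"
  by unfold_locales
    (simp_all add: vec.scale_left_distrib sum.distrib vec.scale_sum_right)

lemma coord_combination_std_basis:
  assumes "n \<le> CARD('k)" "i \<in> {1..n}"
  shows "(\<Sum>j = 1..n. ((std_basis i :: complex ^ 'k::{finite,linorder}) $ coord_index j) *s v j)
    = (v i :: complex ^ 'd)"
proof -
  have "(\<Sum>j = 1..n. ((std_basis i :: (complex, 'k) vec) $ coord_index j) *s v j)
      = (\<Sum>j = 1..n. if j = i then v j else 0)"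
    using assms by (intro sum.cong refl) (auto simp: std_basis_nth_coord_index)
  also have "\<dots> = v i"
    using assms by simp
  finally show ?thesis .
qed

lemma norm_vector_smult: "norm (z *s x) = norm z * norm (x :: complex ^ 'n)"
  by (simp add: norm_vec_def L2_set_def norm_mult power_mult_distrib real_sqrt_mult
      flip: sum_distrib_left)

lemma continuous_on_matrix_vector_mult: "continuous_on S ((*v) (A :: complex ^ 'n ^ 'm))"
  by (auto simp: matrix_vector_mult_def intro!: continuous_intros)

lemma linear_matrix_vector_mult: "linear ((*v) (A :: complex ^ 'n ^ 'm))"
  by (rule linearI)
    (simp_all add: vec_eq_iff matrix_vector_mult_def scaleR_sum_right distrib_left sum.distrib)

section \<open>Complex linear functionals and separation by complex hyperplanes\<close>

definition pairing :: "complex ^ 'n \<Rightarrow> complex ^ 'n \<Rightarrow> complex" where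
  "pairing w x = (\<Sum>i\<in>UNIV. w $ i * x $ i)"

lemma pairing_add: "pairing w (x + y) = pairing w x + pairing w y"
  by (simp add: pairing_def distrib_left sum.distrib)

lemma pairing_scale: "pairing w (c *s x) = c * pairing w x"
  by (simp add: pairing_def sum_distrib_left mult_ac)

lemma pairing_scale_left: "pairing (c *s w) x = c * pairing w x"
  by (simp add: pairing_def sum_distrib_left mult_ac)

lemma pairing_zero: "pairing w 0 = 0"
  by (simp add: pairing_def)

lemma pairing_sum: "pairing w (\<Sum>j\<in>J. f j) = (\<Sum>j\<in>J. pairing w (f j))"
  by (induction J rule: infinite_finite_induct) (simp_all add: pairing_zero pairing_add)

lemma continuous_on_pairing: "continuous_on S (pairing w)"
  by (auto simp: pairing_def[abs_def] intro!: continuous_intros)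

text \<open>The pairing is bilinear, with no conjugate, so conjugating the coordinates of
  \<open>a\<close> exhibits the real functional given by \<open>a\<close> as the real part of a
  complex linear one. This is how a real separating hyperplane becomes complex.\<close>

lemma Re_pairing_cnj: "Re (pairing (\<chi> i. cnj (a $ i)) x) = a \<bullet> x"
  by (simp add: pairing_def inner_vec_def inner_complex_def)

lemma pairing_eq_zero_on_span:
  assumes "\<And>x. x \<in> S \<Longrightarrow> pairing w x = 0" "x \<in> vec.span S"
  shows "pairing w x = 0"
  using assms(2)
  by (induction rule: vec.span_induct_alt) (simp_all add: pairing_zero pairing_add pairing_scale assms(1))

text \<open>Real separation gives a complex functional whose real part is bounded below on the
  translate of \<open>S\<close>. As \<open>S\<close> is a complex subspace, the functional must
  vanish on it, and rescaling makes its value at \<open>p\<close> equal to 1.\<close>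

lemma complex_hyperplane_avoiding_convex:
  fixes \<Omega> S :: "(complex ^ 'n) set"
  assumes "open \<Omega>" "convex \<Omega>" "0 \<in> \<Omega>" "vec.subspace S" "(\<lambda>s. p + s) ` S \<inter> \<Omega> = {}"
  obtains w where "pairing w p = 1" "\<And>s. s \<in> S \<Longrightarrow> pairing w s = 0" "\<And>x. x \<in> \<Omega> \<Longrightarrow> pairing w x \<noteq> 1"
proof -
  have scaleR_eq: "c *\<^sub>R x = complex_of_real c *s x" for c and x :: "complex ^ 'n"
    by (simp add: vec_eq_iff complex_eq_iff)
  have "subspace S"
    using assms(4) unfolding subspace_def vec.subspace_def scaleR_eq by auto
  then have "convex ((\<lambda>s. p + s) ` S)"
    by (intro convex_translation subspace_imp_convex)
  moreover have "0 \<in> S"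
    using assms(4) vec.subspace_0 by blast
  ultimately have "\<exists>a b. a \<noteq> 0 \<and> (\<forall>x\<in>\<Omega>. a \<bullet> x \<le> b) \<and> (\<forall>x\<in>(\<lambda>s. p + s) ` S. a \<bullet> x \<ge> b)"
    using assms(2,3,5) by (intro separating_hyperplane_sets) auto
  then obtain a b where ab: "a \<noteq> 0" "\<And>x. x \<in> \<Omega> \<Longrightarrow> a \<bullet> x \<le> b" "\<And>s. s \<in> S \<Longrightarrow> a \<bullet> (p + s) \<ge> b"
    by blast
  define u where "u = (\<chi> i. cnj (a $ i))"
  have Re_u: "Re (pairing u x) = a \<bullet> x" for x
    unfolding u_def by (rule Re_pairing_cnj)
  \<comment> \<open>Openness makes the inequality strict: a short step from \<open>x\<close> in the
    direction \<open>a\<close> stays in \<open>\<Omega>\<close> and increases the inner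
    product.\<close>
  have lt: "a \<bullet> x < b" if x: "x \<in> \<Omega>" for x
  proof -
    obtain e where e: "e > 0" "cball x e \<subseteq> \<Omega>"
      using assms(1) x open_contains_cball by blast
    have "x + (e / norm a) *\<^sub>R a \<in> cball x e"
      using e ab(1) by (simp add: dist_norm)
    then have "a \<bullet> (x + (e / norm a) *\<^sub>R a) \<le> b"
      using ab(2) e by blast
    moreover have "a \<bullet> ((e / norm a) *\<^sub>R a) > 0"
      using e ab(1) by (simp add: zero_less_mult_iff)
    ultimately show ?thesis
      by (simp add: inner_add_right)
  qed
  have zero: "pairing u s = 0" if "s \<in> S" for s
  proof (rule ccontr)
    assume ne: "pairing u s \<noteq> 0"
    \<comment> \<open>The multiple is chosen so that \<open>p + c *s s\<close>, still in the
      translate, has inner product \<open>b - 1\<close> with \<open>a\<close>.\<close>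
    define c where "c = of_real (b - a \<bullet> p - 1) / pairing u s"
    have "c *s s \<in> S"
      using that assms(4) vec.subspace_scale by blast
    then have "b \<le> a \<bullet> p + a \<bullet> (c *s s)"
      using ab(3) by (simp add: inner_add_right)
    also have "a \<bullet> (c *s s) = b - a \<bullet> p - 1"
      using ne by (simp add: c_def pairing_scale flip: Re_u)
    finally show False
      by simp
  qed
  have p: "Re (pairing u p) \<ge> b"
    using ab(3)[OF \<open>0 \<in> S\<close>] by (simp add: Re_u)
  have x: "Re (pairing u x) < b" if "x \<in> \<Omega>" for x
    using lt[OF that] by (simp add: Re_u)
  \<comment> \<open>Strictness at the origin gives \<open>0 < b\<close>, and \<open>b\<close> is a
    lower bound for the real part at \<open>p\<close>.\<close>
  have "pairing u p \<noteq> 0"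
    using x[OF assms(3)] p by (auto simp: pairing_zero)
  show thesis
  proof (rule that[of "inverse (pairing u p) *s u"])
    show "pairing (inverse (pairing u p) *s u) p = 1"
      using \<open>pairing u p \<noteq> 0\<close> by (simp add: pairing_scale_left)
    show "pairing (inverse (pairing u p) *s u) s = 0" if "s \<in> S" for s
      using zero[OF that] by (simp add: pairing_scale_left)
    show "pairing (inverse (pairing u p) *s u) x \<noteq> 1" if "x \<in> \<Omega>" for x
    proof
      assume "pairing (inverse (pairing u p) *s u) x = 1"
      then have "pairing u x = pairing u p"
        using \<open>pairing u p \<noteq> 0\<close> by (simp add: pairing_scale_left field_simps)
      with x[OF that] p show False
        by simp
    qed
  qed
qed

section \<open>Adapted flags and their extension by nearest points\<close>

lemma common_kernel_nontrivial:
  fixes w :: "nat \<Rightarrow> complex ^ 'd::{finite,linorder}"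
  assumes "k < CARD('d)"
  obtains x where "x \<noteq> 0" "\<And>j. j \<in> {1..k} \<Longrightarrow> pairing (w j) x = 0"
proof -
  \<comment> \<open>The \<open>k\<close> functionals are the first rows of a square matrix, padded
    with zero rows; \<open>inv_into\<close> recovers the number of a row from its index.\<close>
  define M :: "((complex, 'd) vec, 'd) vec" where
    "M = (\<chi> i. if i \<in> coord_index ` {1..k} then w (inv_into {1..CARD('d)} coord_index i) else 0)"
  have M: "(M *v x) $ coord_index j = (if j \<le> k then pairing (w j) x else 0)"
    if "j \<in> {1..CARD('d)}" for j x
  proof -
    have "inv_into {1..CARD('d)} coord_index (coord_index j :: 'd) = j"
      using that bij_betw_coord_index[where 'k = 'd] by (meson bij_betw_def inv_into_f_f)
    moreover have "(coord_index j :: 'd) \<in> coord_index ` {1..k} \<longleftrightarrow> j \<le> k"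
    proof
      assume "(coord_index j :: 'd) \<in> coord_index ` {1..k}"
      then obtain i where "i \<in> {1..k}" "(coord_index j :: 'd) = coord_index i"
        by auto
      then show "j \<le> k"
        using that assms coord_index_eq_iff[of j i, where 'k = 'd] by auto
    qed (use that in auto)
    ultimately show ?thesis
      by (simp add: M_def matrix_vector_mult_def pairing_def)
  qed
  \<comment> \<open>Row \<open>k + 1\<close> is zero, so \<open>std_basis (k + 1)\<close> is not a
    value of \<open>M\<close>; a square matrix that is not surjective has a nonzero kernel.\<close>
  have "\<not> surj ((*v) M)"
  proof
    assume "surj ((*v) M)"
    then obtain x where "M *v x = std_basis (k + 1)"
      by (metis surjD)
    moreover have "(std_basis (k + 1) :: (complex, 'd) vec) $ coord_index (k + 1) = 1"
      by (simp add: std_basis_def)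
    ultimately show False
      using M[of "k + 1" x] assms by simp
  qed
  then have "\<not> inj ((*v) M)"
    using matrix_left_invertible_injective matrix_right_invertible_surjective
      matrix_left_right_inverse by metis
  then obtain x where "x \<noteq> 0" "M *v x = 0"
    using vec.inj_iff_eq_0 by metis
  show thesis
  proof (rule that[of x])
    show "pairing (w j) x = 0" if "j \<in> {1..k}" for j
      using M[of j x] \<open>M *v x = 0\<close> that assms by simp
  qed fact
qed

text \<open>
  The hyperplanes \<open>{x. pairing (w j) x = 1}\<close> witness that \<open>v j + span {v (j + 1), \<dots>, v k}\<close>
  misses the domain.
\<close>

definition adapted_flag ::
  "real \<Rightarrow> (complex ^ 'd) set \<Rightarrow> nat \<Rightarrow> (nat \<Rightarrow> complex ^ 'd) \<Rightarrow> (nat \<Rightarrow> complex ^ 'd) \<Rightarrow> bool" where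
  "adapted_flag r \<Omega> k v w \<longleftrightarrow> (\<forall>j\<in>{1..k}.
     v j \<in> closure \<Omega> \<and>
     (\<forall>z. norm z < (if j = 1 then r else 1) \<longrightarrow> z *s v j \<in> \<Omega>) \<and>
     pairing (w j) (v j) = 1 \<and> (\<forall>i\<in>{j+1..k}. pairing (w j) (v i) = 0) \<and>
     (\<forall>x\<in>\<Omega>. pairing (w j) x \<noteq> 1))"

text \<open>Choosing the new vector in the common kernel \<open>V\<close> makes the old functionals
  vanish on it, which preserves triangularity. Since \<open>1 \<le> k\<close>, the new index is
  never 1, so its disc must have radius 1 rather than \<open>r\<close>.\<close>

lemma adapted_flag_extend_one:
  fixes \<Omega> :: "(complex ^ 'd::{finite,linorder}) set"
  assumes "0 < r" "C_properly_convex_domain \<Omega>" "1 \<le> k" "k < CARD('d)"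
    and flag: "adapted_flag r \<Omega> k v w"
  obtains v' w' where "adapted_flag r \<Omega> (Suc k) v' w'" "\<And>j. j \<in> {1..k} \<Longrightarrow> v' j = v j"
proof -
  have \<Omega>: "open \<Omega>" "convex \<Omega>"
    and no_line: "\<And>p u. u \<noteq> 0 \<Longrightarrow> \<not> range (\<lambda>z. p + z *s u) \<subseteq> \<Omega>"
    using assms(2) unfolding C_properly_convex_domain_def convex_domain_def by auto
  \<comment> \<open>The origin lies in \<open>\<Omega>\<close> as the centre of the first
    disc.\<close>
  have "\<forall>z. norm z < r \<longrightarrow> z *s v 1 \<in> \<Omega>"
    using flag[unfolded adapted_flag_def, THEN bspec, of 1] assms(3) by simp
  then have "0 \<in> \<Omega>"
    using assms(1) by (metis norm_zero vec.scale_zero_left)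
  define V where "V = (\<Inter>j\<in>{1..k}. {x. pairing (w j) x = 0})"
  obtain u where u: "u \<noteq> 0" "\<And>j. j \<in> {1..k} \<Longrightarrow> pairing (w j) u = 0"
    using common_kernel_nontrivial[OF assms(4)] by blast
  have "\<not> range (\<lambda>z. 0 + z *s u) \<subseteq> \<Omega>"
    by (rule no_line[OF u(1)])
  then obtain c where "c *s u \<notin> \<Omega>"
    by auto
  moreover have "c *s u \<in> V"
    by (auto simp: V_def pairing_scale u(2))
  ultimately have "V - \<Omega> \<noteq> {}"
    by auto
  moreover have "closed (V - \<Omega>)"
    unfolding V_def
    by (intro closed_Diff \<Omega> closed_INT ballI closed_Collect_eq continuous_on_pairing continuous_on_const)
  ultimately obtain q where q: "q \<in> V - \<Omega>" "\<And>y. y \<in> V - \<Omega> \<Longrightarrow> dist 0 q \<le> dist 0 y"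
    using distance_attains_inf[of "V - \<Omega>" 0] by metis
  have "q \<noteq> 0"
    using q(1) \<open>0 \<in> \<Omega>\<close> by auto
  \<comment> \<open>A multiple of \<open>q\<close> by a scalar of modulus below 1 stays in
    \<open>V\<close> and is strictly closer to the origin, so by minimality it cannot lie outside
    \<open>\<Omega>\<close>.\<close>
  have disc: "z *s q \<in> \<Omega>" if "norm z < 1" for z
  proof (rule ccontr)
    assume "z *s q \<notin> \<Omega>"
    moreover have "z *s q \<in> V"
      using q(1) by (auto simp: V_def pairing_scale)
    ultimately have "norm q \<le> norm z * norm q"
      using q(2)[of "z *s q"] by (simp add: norm_vector_smult)
    then show False
      using that \<open>q \<noteq> 0\<close> by simp
  qed
  \<comment> \<open>Points of the disc tending to \<open>q\<close> place it in the closure.\<close>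
  have "(\<lambda>n. (1 - inverse (of_nat (Suc n))) *s q) \<longlonglongrightarrow> (1 - 0) *s q"
    unfolding vector_scalar_mult_def
    by (intro tendsto_vec_lambda tendsto_intros LIMSEQ_Suc[OF lim_inverse_n])
  moreover have "(1 - inverse (of_nat (Suc n))) *s q \<in> \<Omega>" for n
  proof (rule disc)
    have "(1 - inverse (of_nat (Suc n)) :: complex) = of_real (1 - inverse (real (Suc n)))"
      by simp
    moreover have "\<bar>1 - inverse (real (Suc n))\<bar> < 1"
      by (auto simp: field_simps)
    ultimately show "norm (1 - inverse (of_nat (Suc n)) :: complex) < 1"
      by (metis norm_of_real)
  qed
  ultimately have "q \<in> closure \<Omega>"
    unfolding closure_sequential
    by (intro exI[of _ "\<lambda>n. (1 - inverse (of_nat (Suc n))) *s q"]) simp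
  \<comment> \<open>No vector follows \<open>q\<close> yet, so the subspace to separate is
    \<open>{0}\<close>; later vectors will be taken from the kernel of \<open>y\<close>.\<close>
  obtain y where y: "pairing y q = 1" "\<And>x. x \<in> \<Omega> \<Longrightarrow> pairing y x \<noteq> 1"
  proof (rule complex_hyperplane_avoiding_convex[OF \<Omega> \<open>0 \<in> \<Omega>\<close> vec.subspace_single_0])
    show "(\<lambda>s. q + s) ` {0} \<inter> \<Omega> = {}"
      using q(1) by auto
  qed blast
  show thesis
  proof (rule that[of "v(Suc k := q)" "w(Suc k := y)"])
    show "adapted_flag r \<Omega> (Suc k) (v(Suc k := q)) (w(Suc k := y))"
      unfolding adapted_flag_def
    proof
      fix j assume j: "j \<in> {1..Suc k}"
      show "(v(Suc k := q)) j \<in> closure \<Omega> \<and>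
        (\<forall>z. norm z < (if j = 1 then r else 1) \<longrightarrow> z *s (v(Suc k := q)) j \<in> \<Omega>) \<and>
        pairing ((w(Suc k := y)) j) ((v(Suc k := q)) j) = 1 \<and>
        (\<forall>i\<in>{j+1..Suc k}. pairing ((w(Suc k := y)) j) ((v(Suc k := q)) i) = 0) \<and>
        (\<forall>x\<in>\<Omega>. pairing ((w(Suc k := y)) j) x \<noteq> 1)"
      proof (cases "j = Suc k")
        case True
        then show ?thesis
          using assms(3) \<open>q \<in> closure \<Omega>\<close> disc y by auto
      next
        case False
        then have "j \<in> {1..k}"
          using j by auto
        moreover from this have "pairing (w j) q = 0"
          using q(1) by (auto simp: V_def)
        ultimately show ?thesis
          using flag False unfolding adapted_flag_def by (auto dest!: bspec[of _ _ j])
      qed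
    qed
  qed auto
qed

lemma adapted_flag_extend:
  fixes \<Omega> :: "(complex ^ 'd::{finite,linorder}) set"
  assumes "0 < r" "C_properly_convex_domain \<Omega>" "1 \<le> k" "k \<le> CARD('d)"
    and "adapted_flag r \<Omega> k v w"
  shows "\<exists>v' w'. adapted_flag r \<Omega> CARD('d) v' w' \<and> (\<forall>j\<in>{1..k}. v' j = v j)"
  using assms(4,3,5)
\<comment> \<open>The induction runs downwards from \<open>CARD('d)\<close>. The flag is generalised
  because each extension replaces both \<open>v\<close> and \<open>w\<close>.\<close>
proof (induction k arbitrary: v w rule: inc_induct)
  case base
  then show ?case
    by blast
next
  case (step k)
  obtain v1 w1 where 1: "adapted_flag r \<Omega> (Suc k) v1 w1" "\<And>j. j \<in> {1..k} \<Longrightarrow> v1 j = v j"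
    using adapted_flag_extend_one[OF assms(1-2) step.prems(1) step.hyps(2) step.prems(2)] by blast
  obtain v2 w2 where "adapted_flag r \<Omega> CARD('d) v2 w2" "\<forall>j\<in>{1..Suc k}. v2 j = v1 j"
    using step.IH[OF _ 1(1)] by auto
  with 1(2) show ?case
    by (intro exI[of _ v2] exI[of _ w2]) auto
qed

section \<open>From a complete flag to the linear change of coordinates\<close>

lemma adapted_flag_imp_KK:
  fixes \<Omega> :: "(complex ^ 'd::{finite,linorder}) set"
  assumes "C_properly_convex_domain \<Omega>" and flag: "adapted_flag r \<Omega> CARD('d) v w"
  obtains A :: "complex ^ 'd::{finite,linorder} ^ 'd::{finite,linorder}" where "invertible A" "(*v) A ` \<Omega> \<in> KK r"
    "\<And>j. j \<in> {1..CARD('d)} \<Longrightarrow> A *v v j = std_basis j"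
proof -
  have \<Omega>: "open \<Omega>" "convex \<Omega>" "\<Omega> \<noteq> {}"
    and no_line: "\<And>p u. u \<noteq> 0 \<Longrightarrow> \<not> range (\<lambda>z. p + z *s u) \<subseteq> \<Omega>"
    using assms(1) unfolding C_properly_convex_domain_def convex_domain_def by auto
  note flagD = flag[unfolded adapted_flag_def, rule_format]
  \<comment> \<open>\<open>B\<close> sends \<open>std_basis j\<close> to \<open>v j\<close>; the
    wanted \<open>A\<close> is its inverse.\<close>
  define B :: "((complex, 'd) vec, 'd) vec" where
    "B = matrix (\<lambda>x. \<Sum>j = 1..CARD('d). (x $ coord_index j) *s v j)"
  have B: "B *v x = (\<Sum>j = 1..CARD('d). (x $ coord_index j) *s v j)" for x
    unfolding B_def by (rule matrix_works[OF linear_coord_combination])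
  have B_std_basis: "B *v std_basis j = v j" if "j \<in> {1..CARD('d)}" for j
    using coord_combination_std_basis[OF order_refl that] by (simp add: B)
  have "x = 0" if "B *v x = 0" for x
  proof -
    have zero: "x $ coord_index j = 0" if "j \<in> {1..CARD('d)}" for j
      using that
    proof (induction j rule: less_induct)
      case (less j)
      \<comment> \<open>Applying \<open>w j\<close> isolates coordinate \<open>j\<close>: terms with
        larger index vanish by the flag, those with smaller index by the induction
        hypothesis.\<close>
      have "0 = pairing (w j) (B *v x)"
        using \<open>B *v x = 0\<close> by (simp add: pairing_zero)
      also have "\<dots> = (\<Sum>i = 1..CARD('d). (x $ coord_index i) * pairing (w j) (v i))"
        by (simp add: B pairing_sum pairing_scale)
      also have "\<dots> = (\<Sum>i = 1..CARD('d). if i = j then x $ coord_index j else 0)"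
      proof (intro sum.cong refl)
        fix i assume "i \<in> {1..CARD('d)}"
        then show "(x $ coord_index i) * pairing (w j) (v i) = (if i = j then x $ coord_index j else 0)"
          using less flagD[of j] by (cases i j rule: linorder_cases) auto
      qed
      also have "\<dots> = x $ coord_index j"
        using less.prems by simp
      finally show ?case
        by simp
    qed
    have "x $ i = 0" for i
      by (rule coord_index_cases[of i]) (simp add: zero)
    then show ?thesis
      by (simp add: vec_eq_iff)
  qed
  then obtain A where AB: "A ** B = mat 1"
    using matrix_left_invertible_ker by blast
  then have BA: "B ** A = mat 1"
    using matrix_left_right_inverse by blast
  have A_B: "A *v (B *v x) = x" and B_A: "B *v (A *v x) = x" for x
    using AB BA by (simp_all add: matrix_vector_mul_assoc)
  \<comment> \<open>Each condition on the image under \<open>A\<close> can now be checked in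
    \<open>\<Omega>\<close> after applying \<open>B\<close>.\<close>
  have mem: "x \<in> (*v) A ` \<Omega> \<longleftrightarrow> B *v x \<in> \<Omega>" for x
    using A_B B_A by (metis imageE imageI)
  have "open ((*v) A ` \<Omega>)"
  proof -
    have "(*v) A ` \<Omega> = (*v) B -` \<Omega>"
      using mem by auto
    then show ?thesis
      using \<Omega>(1) continuous_on_matrix_vector_mult by (metis open_vimage)
  qed
  moreover have "convex ((*v) A ` \<Omega>)"
    by (intro convex_linear_image linear_matrix_vector_mult \<Omega>)
  moreover have "\<not> range (\<lambda>z. p + z *s u) \<subseteq> (*v) A ` \<Omega>" if "u \<noteq> 0" for p u
  proof
    assume sub: "range (\<lambda>z. p + z *s u) \<subseteq> (*v) A ` \<Omega>"
    have "B *v u \<noteq> 0"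
      using that A_B[of u] by auto
    then have "\<not> range (\<lambda>z. B *v p + z *s (B *v u)) \<subseteq> \<Omega>"
      by (rule no_line)
    moreover have "B *v p + z *s (B *v u) \<in> \<Omega>" for z
    proof -
      have "p + z *s u \<in> (*v) A ` \<Omega>"
        using sub by auto
      then show ?thesis
        by (simp add: mem matrix_vector_right_distrib vector_scalar_commute)
    qed
    ultimately show False
      by auto
  qed
  ultimately have proper: "C_properly_convex_domain ((*v) A ` \<Omega>)"
    using \<Omega>(3) unfolding C_properly_convex_domain_def convex_domain_def by auto
  have disc: "z *s std_basis j \<in> (*v) A ` \<Omega>"
    if "j \<in> {1..CARD('d)}" "norm z < (if j = 1 then r else 1)" for j z
    using flagD[OF that(1)] that by (simp add: mem vector_scalar_commute B_std_basis)
  \<comment> \<open>\<open>B\<close> carries the span of the later basis vectors to the span of the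
    later \<open>v i\<close>, where \<open>w j\<close> vanishes. Hence \<open>w j\<close> is 1 on
    the whole translate, a value it never takes on \<open>\<Omega>\<close>.\<close>
  have avoid: "std_basis j + x \<notin> (*v) A ` \<Omega>"
    if j: "j \<in> {1..CARD('d)}" and x: "x \<in> vec.span (std_basis ` {j+1..CARD('d)})" for j x
  proof -
    have "B *v x \<in> (*v) B ` vec.span (std_basis ` {j+1..CARD('d)})"
      using x by blast
    also have "\<dots> = vec.span ((*v) B ` std_basis ` {j+1..CARD('d)})"
      by (simp add: vec.linear_span_image)
    finally have "pairing (w j) (B *v x) = 0"
      by (rule pairing_eq_zero_on_span[rotated]) (use flagD[OF j] in \<open>auto simp: B_std_basis\<close>)
    then have "pairing (w j) (B *v (std_basis j + x)) = 1"
      using flagD[OF j] by (simp add: matrix_vector_right_distrib pairing_add B_std_basis[OF j])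
    then show ?thesis
      using flagD[OF j] by (auto simp: mem)
  qed
  have A_v: "A *v v j = std_basis j" if "j \<in> {1..CARD('d)}" for j
    using A_B[of "std_basis j"] by (simp add: B_std_basis[OF that])
  have frontier: "std_basis j \<in> frontier ((*v) A ` \<Omega>)" if j: "j \<in> {1..CARD('d)}" for j
  proof -
    have "A *v v j \<in> closure ((*v) A ` \<Omega>)"
      using image_closure_subset[OF continuous_on_matrix_vector_mult closed_closure, of A \<Omega> "(*v) A ` \<Omega>"]
        closure_subset flagD[OF j] by blast
    moreover have "std_basis j \<notin> (*v) A ` \<Omega>"
      using avoid[OF j vec.span_zero] by simp
    ultimately show ?thesis
      using \<open>open ((*v) A ` \<Omega>)\<close> by (simp add: A_v[OF j] frontier_def interior_open)
  qed
  show thesis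
  proof (rule that[of A])
    show "invertible A"
      using AB BA by (auto simp: invertible_def)
    show "(*v) A ` \<Omega> \<in> KK r"
      unfolding KK_def
    proof (intro CollectI conjI ballI)
      show "(\<lambda>z. z *s std_basis 1) ` ball 0 r \<subseteq> (*v) A ` \<Omega>"
        using disc[of 1] by (auto simp: Suc_le_eq)
      show "(\<lambda>z. z *s std_basis j) ` ball 0 1 \<subseteq> (*v) A ` \<Omega>" if "j \<in> {2..CARD('d)}" for j
        using disc[of j] that by auto
      show "(\<lambda>x. std_basis j + x) ` vec.span (std_basis ` {j+1..CARD('d)}) \<inter> (*v) A ` \<Omega> = {}"
        if "j \<in> {1..CARD('d)}" for j
        using avoid[OF that] by blast
    qed (fact proper frontier)+
  qed (rule A_v)
qed

section \<open>The initial flag supplied by the slice, and the conclusion\<close>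

lemma coord_embed_std_basis:
  assumes "j \<in> {1..CARD('m)}"
  shows "(coord_embed (std_basis j :: complex ^ 'm::{finite,linorder}) :: complex ^ 'd::{finite,linorder})
    = std_basis j"
  unfolding coord_embed_def by (rule coord_combination_std_basis[OF order_refl assms])

lemma linear_coord_embed:
  "Vector_Spaces.linear (*s) (*s)
     (coord_embed :: complex ^ 'm::{finite,linorder} \<Rightarrow> complex ^ 'd::{finite,linorder})"
  unfolding coord_embed_def[abs_def] by (rule linear_coord_combination)

lemma coord_embed_in_span:
  "(coord_embed (x :: complex ^ 'm::{finite,linorder}) :: complex ^ 'd::{finite,linorder})
    \<in> vec.span (std_basis ` {1..CARD('m)})"
  unfolding coord_embed_def by (intro vec.span_sum vec.span_scale vec.span_base) auto

text \<open>The discs and closure points transfer along \<open>coord_embed\<close>. The affine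
  subspaces in condition (ii) lie in the span of the first coordinates, so missing the slice means
  missing \<open>\<Omega>\<close> itself, and separation can be done in the large space.\<close>

lemma adapted_flag_of_KK_slice:
  fixes \<Omega> :: "(complex ^ 'd::{finite,linorder}) set"
  assumes "0 < r" "C_properly_convex_domain \<Omega>"
    and "(coord_embed :: complex ^ 'm::{finite,linorder} \<Rightarrow> complex ^ 'd::{finite,linorder}) -`
           (\<Omega> \<inter> vec.span (std_basis ` {1..CARD('m)})) \<in> KK r"
  obtains w where "adapted_flag r \<Omega> CARD('m) std_basis w"
proof -
  let ?emb = "coord_embed :: (complex, 'm) vec \<Rightarrow> (complex, 'd) vec"
  have \<Omega>: "open \<Omega>" "convex \<Omega>"
    using assms(2) unfolding C_properly_convex_domain_def convex_domain_def by auto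
  define \<Omega>' where "\<Omega>' = ?emb -` \<Omega>"
  have "?emb -` (\<Omega> \<inter> vec.span (std_basis ` {1..CARD('m)})) = \<Omega>'"
    using coord_embed_in_span by (auto simp: \<Omega>'_def)
  with assms(3) have K: "\<Omega>' \<in> KK r"
    by simp
  have disc: "z *s std_basis j \<in> \<Omega>"
    if j: "j \<in> {1..CARD('m)}" and z: "norm z < (if j = 1 then r else 1)" for j z
  proof -
    have "z *s std_basis j \<in> \<Omega>'"
      using K that unfolding KK_def by (cases "j = 1") (auto simp: image_subset_iff)
    then show ?thesis
      using coord_embed_std_basis[OF j, where 'd = 'd]
      by (simp add: \<Omega>'_def vec.linear_scale[OF linear_coord_embed])
  qed
  have "0 *s std_basis 1 \<in> \<Omega>"
    by (rule disc) (use assms(1) in auto)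
  then have "0 \<in> \<Omega>"
    by simp
  have clos: "std_basis j \<in> closure \<Omega>" if j: "j \<in> {1..CARD('m)}" for j
  proof -
    have "std_basis j \<in> closure \<Omega>'"
      using K j unfolding KK_def by (auto simp: frontier_def)
    moreover have "continuous_on (closure \<Omega>') ?emb"
      using matrix_works[OF linear_coord_embed, symmetric] continuous_on_matrix_vector_mult
      by (metis continuous_on_cong)
    then have "?emb ` closure \<Omega>' \<subseteq> closure \<Omega>"
      by (rule image_closure_subset[OF _ closed_closure])
        (use closure_subset[of \<Omega>] in \<open>auto simp: \<Omega>'_def\<close>)
    ultimately show ?thesis
      by (metis coord_embed_std_basis image_subset_iff j)
  qed
  have "\<exists>w. pairing w (std_basis j) = 1 \<and> (\<forall>i\<in>{j+1..CARD('m)}. pairing w (std_basis i) = 0) \<and>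
      (\<forall>x\<in>\<Omega>. pairing w x \<noteq> 1)" if j: "j \<in> {1..CARD('m)}" for j
  proof -
    let ?S = "vec.span (std_basis ` {j+1..CARD('m)}) :: ((complex, 'd) vec) set"
    have "std_basis j + s \<notin> \<Omega>" if "s \<in> ?S" for s
    proof -
      \<comment> \<open>Each vector of this span comes from the corresponding span in the small
        space, where condition (ii) for the slice applies.\<close>
      have "?S = vec.span (?emb ` std_basis ` {j+1..CARD('m)})"
        unfolding image_image by (intro arg_cong[of _ _ vec.span] image_cong refl)
          (auto simp: coord_embed_std_basis)
      also have "\<dots> = ?emb ` vec.span (std_basis ` {j+1..CARD('m)})"
        by (simp add: vec.linear_span_image linear_coord_embed)
      finally have "s \<in> ?emb ` vec.span (std_basis ` {j+1..CARD('m)})"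
        using that by (rule subst)
      then obtain t where t: "s = ?emb t" "t \<in> vec.span (std_basis ` {j+1..CARD('m)})"
        by blast
      have "std_basis j + t \<notin> \<Omega>'"
        using K j t(2) unfolding KK_def by blast
      then show ?thesis
        using coord_embed_std_basis[OF j, where 'd = 'd]
        by (simp add: \<Omega>'_def t(1) vec.linear_add[OF linear_coord_embed])
    qed
    then have "(\<lambda>s. std_basis j + s) ` ?S \<inter> \<Omega> = {}"
      by auto
    then show ?thesis
      using complex_hyperplane_avoiding_convex[OF \<Omega> \<open>0 \<in> \<Omega>\<close> vec.subspace_span]
      by (metis imageI vec.span_base)
  qed
  then obtain w where "\<forall>j\<in>{1..CARD('m)}. pairing (w j) (std_basis j) = 1 \<and>
      (\<forall>i\<in>{j+1..CARD('m)}. pairing (w j) (std_basis i) = 0) \<and> (\<forall>x\<in>\<Omega>. pairing (w j) x \<noteq> 1)"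
    by metis
  with disc clos show thesis
    by (intro that[of w]) (auto simp: adapted_flag_def)
qed

theorem proposition4p6:
  fixes r :: real and \<Omega> :: "(complex ^ 'd::{finite,linorder}) set"
  assumes "0 < r" and "r \<le> 1"
    and "C_properly_convex_domain \<Omega>"
    and "CARD('m::{finite,linorder}) \<le> CARD('d)"
    and "(coord_embed :: complex ^ 'm::{finite,linorder} \<Rightarrow> complex ^ 'd::{finite,linorder}) -`
           (\<Omega> \<inter> vec.span (std_basis ` {1..CARD('m)})) \<in> KK r"
  shows "\<exists>A :: complex ^ 'd::{finite,linorder} ^ 'd::{finite,linorder}. invertible A \<and> (*v) A ` \<Omega> \<in> KK r \<and>
           (\<forall>z \<in> vec.span (std_basis ` {1..CARD('m)}). A *v z = z)"
proof -
  obtain w where "adapted_flag r \<Omega> CARD('m) std_basis w"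
    using adapted_flag_of_KK_slice[OF assms(1,3,5)] by blast
  moreover have "1 \<le> CARD('m)"
    by (simp add: Suc_le_eq)
  ultimately obtain v' w' where v': "adapted_flag r \<Omega> CARD('d) v' w'"
    "\<forall>j\<in>{1..CARD('m)}. v' j = std_basis j"
    using adapted_flag_extend[OF assms(1,3) _ assms(4)] by blast
  obtain A :: "((complex, 'd) vec, 'd) vec" where A: "invertible A" "(*v) A ` \<Omega> \<in> KK r"
    "\<And>j. j \<in> {1..CARD('d)} \<Longrightarrow> A *v v' j = std_basis j"
    using adapted_flag_imp_KK[OF assms(3) v'(1)] by blast
  have fixed: "A *v std_basis j = std_basis j" if "j \<in> {1..CARD('m)}" for j
    using A(3)[of j] v'(2) that assms(4) by auto
  \<comment> \<open>Two linear maps agreeing on a spanning set agree on the span; writing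
    \<open>id\<close> makes the right-hand side such a map.\<close>
  have "A *v z = id z" if "z \<in> vec.span (std_basis ` {1..CARD('m)})" for z
    by (rule vec.linear_eq_on[OF matrix_vector_mul_linear_gen vec.linear_id that])
      (auto simp: fixed)
  with A(1,2) show ?thesis
    by auto
qed

end
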